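(* Let $V$ and $Q$ be real separable Hilbert spaces, $X=V\times Q$, $L\in L(V,V')$, $B\in L(V,Q')$, and let $A\in L(X,X')$ be of saddle-point form $$A(u,p)=\bigl(Lu-B^*p,\;Bu\bigr),\qquad (u,p)\in V\times Q.$$ Assume (A1) there is $\alpha>0$ with $\langle Lu,u\rangle_{V',V}\ge\alpha\|u\|_V^2$ for all $u\in V$; (A2) there is $\Theta\in L(Q,V)$ which is onto and satisfies $\langle B^*p,\Theta p\rangle_{V',V}\ge\|p\|_Q^2$ for all $p\in Q$. Then $A$ is linearly mapped coercive.
   Context: $L(\cdot,\cdot)$ denotes bounded linear operators. $X'$ is identified with $V'\times Q'$ via $\langle (f,g),(v,q)\rangle_{X',X}=\langle f,v\rangle_{V',V}+\langle g,q\rangle_{Q',Q}$; $\|(u,p)\|_X^2=\|u\|_V^2+\|p\|_Q^2$; $B^*\in L(Q,V')$ is defined by $\langle B^*p,v\rangle_{V',V}=\langle Bv,p\rangle_{Q',Q}$. An operator $A:X\to Y'$ is called linearly mapped coercive if there is a bounded linear surjective map $\Phi\in L(X,Y)$ such that $\liminf_{\|x\|_X\to\infty}\frac{\langle A(x),\Phi x\rangle_{Y',Y}}{\|x\|_X}=+\infty$; here $Y=X$. *)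

theory Defs
  imports "HOL-Analysis.Analysis"
begin

type_synonym 'a dual = "'a \<Rightarrow>\<^sub>L real"

(* The element of (V \<times> Q)' that represents (f, g) in V' \<times> Q'. *)
definition dual_pair ::
    "'v::real_normed_vector dual \<Rightarrow> 'q::real_normed_vector dual \<Rightarrow> ('v \<times> 'q) dual"
  where "dual_pair f g = (f o\<^sub>L fst_blinfun) + (g o\<^sub>L snd_blinfun)"

lemma dual_pair_apply: "dual_pair f g (v, q) = f v + g q"
  by (simp add: dual_pair_def blinfun.add_left snd_blinfun.rep_eq)

definition dual_operator ::
    "('v::real_normed_vector \<Rightarrow>\<^sub>L 'q::real_normed_vector dual) \<Rightarrow> ('q \<Rightarrow>\<^sub>L 'v dual)"
  where "dual_operator B = Blinfun (\<lambda>p. Blinfun (\<lambda>v. B v p))"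

(* Both arguments of Blinfun in the definition are bounded linear, so the
   junk values of Blinfun play no role. *)
lemma dual_operator_apply: "dual_operator B p v = B v p"
proof -
  interpret bil: bounded_bilinear "\<lambda>p v. B v p"
    by (rule bounded_bilinear.flip
        [OF bounded_bilinear.comp1[OF bounded_bilinear_blinfun_apply blinfun.bounded_linear_right]])
  have inner: "Blinfun (\<lambda>v. B v p) = bil.prod_right p" for p
    by (simp add: bil.prod_right_def)
  show ?thesis
    by (simp add: dual_operator_def inner bounded_linear_Blinfun_apply
        bil.bounded_linear_prod_right bil.prod_right.rep_eq)
qed

(* A is an arbitrary, possibly nonlinear, map from X to Y'. *)
definition linearly_mapped_coercive ::
    "('x::real_normed_vector \<Rightarrow> 'y::real_normed_vector dual) \<Rightarrow> bool"
  where "linearly_mapped_coercive A \<longleftrightarrow>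
    (\<exists>\<Phi> :: 'x \<Rightarrow>\<^sub>L 'y. surj \<Phi> \<and>
       Liminf at_infinity (\<lambda>x. ereal (A x (\<Phi> x) / norm x)) = \<infinity>)"

end

theory Submission
  imports Defs
begin

text \<open>The map \<open>\<Phi>(u, p) = (u - \<epsilon> \<Theta>p, p)\<close> is triangular, hence onto. Testing with it cancels the
  coupling terms \<open>\<langle>Bu, p\<rangle>\<close> and leaves
  \<open>\<langle>A(u, p), \<Phi>(u, p)\<rangle> = \<langle>Lu, u\<rangle> - \<epsilon> \<langle>Lu, \<Theta>p\<rangle> + \<epsilon> \<langle>B\<^sup>*p, \<Theta>p\<rangle>\<close>.
  For \<open>\<epsilon>\<close> small compared with \<open>\<alpha>\<close>, Young's inequality absorbs the mixed term into the other two,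
  so this is at least \<open>c \<parallel>(u, p)\<parallel>\<^sup>2\<close> with \<open>c > 0\<close>.\<close>

text \<open>Dividing a quadratic lower bound by \<open>norm x\<close> leaves
  \<open>c * norm x\<close>, which eventually exceeds every real \<open>C\<close>.\<close>

lemma linearly_mapped_coerciveI:
  fixes A :: "'x::real_normed_vector \<Rightarrow> 'y::real_normed_vector dual"
    and \<Phi> :: "'x \<Rightarrow>\<^sub>L 'y"
  assumes "surj \<Phi>" and "c > 0" and bound: "\<And>x. c * (norm x)\<^sup>2 \<le> A x (\<Phi> x)"
  shows "linearly_mapped_coercive A"
proof -
  have "ereal C \<le> Liminf at_infinity (\<lambda>x. ereal (A x (\<Phi> x) / norm x))" for C
  proof (rule Liminf_bounded)
    \<comment> \<open>In the threshold, \<open>C / c\<close> gives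
      \<open>C \<le> c * norm x\<close>, and 1 keeps the divisor \<open>norm x\<close>
      positive.\<close>
    have "ereal C \<le> ereal (A x (\<Phi> x) / norm x)" if x: "max 1 (C / c) \<le> norm x" for x
    proof -
      have "C \<le> c * norm x"
        using x \<open>c > 0\<close> by (simp add: field_simps)
      also have "\<dots> \<le> A x (\<Phi> x) / norm x"
      proof -
        have "0 < norm x"
          using x by linarith
        then show ?thesis
          using bound[of x] by (simp add: pos_le_divide_eq power2_eq_square mult.assoc)
      qed
      finally show ?thesis by simp
    qed
    then show "\<forall>\<^sub>F x in at_infinity. ereal C \<le> ereal (A x (\<Phi> x) / norm x)"
      unfolding eventually_at_infinity by blast
  qed
  then have "Liminf at_infinity (\<lambda>x. ereal (A x (\<Phi> x) / norm x)) = \<infinity>"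
    by (rule ereal_top)
  with \<open>surj \<Phi>\<close> show ?thesis
    unfolding linearly_mapped_coercive_def by blast
qed

lemma surj_shear: "surj (\<lambda>(u :: 'a::group_add, p). (u - f p, p))"
  by (rule surjI[where f = "\<lambda>(u, p). (u + f p, p)"]) auto

text \<open>Expanding \<open>(M * a - b)\<^sup>2\<close> bounds the mixed term by half of
  \<open>\<epsilon> * M\<^sup>2 * a\<^sup>2\<close> plus half of
  \<open>\<epsilon> * b\<^sup>2\<close>; the smallness of \<epsilon> turns the former into half of
  \<open>\<alpha> * a\<^sup>2\<close>.\<close>

lemma absorb_mixed_term:
  fixes \<alpha> \<epsilon> M a b :: real
  assumes "0 \<le> \<epsilon>" and "\<epsilon> * M\<^sup>2 \<le> \<alpha>"
  shows "\<alpha> / 2 * a\<^sup>2 + \<epsilon> / 2 * b\<^sup>2 \<le> \<alpha> * a\<^sup>2 - \<epsilon> * (M * a * b) + \<epsilon> * b\<^sup>2"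
proof -
  have "0 \<le> \<epsilon> * (M * a - b)\<^sup>2"
    using assms by simp
  moreover have "\<epsilon> * M\<^sup>2 * a\<^sup>2 \<le> \<alpha> * a\<^sup>2"
    using assms by (intro mult_right_mono) auto
  ultimately show ?thesis
    by (simp add: power2_eq_square algebra_simps)
qed

theorem proposition3p1:
  fixes L :: "'v::{real_inner, complete_space} \<Rightarrow>\<^sub>L 'v dual"
    and B :: "'v \<Rightarrow>\<^sub>L 'q::{real_inner, complete_space} dual"
    and A :: "('v \<times> 'q) \<Rightarrow>\<^sub>L ('v \<times> 'q) dual"
  assumes "separable_space (euclidean :: 'v topology)"
    and "separable_space (euclidean :: 'q topology)"
    and "\<And>u p. A (u, p) = dual_pair (L u - dual_operator B p) (B u)"
    and A1: "\<exists>\<alpha>>0. \<forall>u. L u u \<ge> \<alpha> * (norm u)\<^sup>2"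
    and A2: "\<exists>\<Theta> :: 'q \<Rightarrow>\<^sub>L 'v. surj \<Theta> \<and> (\<forall>p. dual_operator B p (\<Theta> p) \<ge> (norm p)\<^sup>2)"
  shows "linearly_mapped_coercive A"
proof -
  obtain \<alpha> where \<alpha>: "\<alpha> > 0" "\<And>u. \<alpha> * (norm u)\<^sup>2 \<le> L u u"
    using A1 by blast
  obtain \<Theta> :: "'q \<Rightarrow>\<^sub>L 'v" where \<Theta>: "\<And>p. (norm p)\<^sup>2 \<le> B (\<Theta> p) p"
    using A2 by (auto simp: dual_operator_apply)
  define M where "M = norm L * norm \<Theta>"
  \<comment> \<open>The summand 1 keeps the denominator positive even if \<open>M = 0\<close>, while
    still \<open>\<epsilon> * M\<^sup>2 \<le> \<alpha>\<close>.\<close>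
  define \<epsilon> where "\<epsilon> = \<alpha> / (M\<^sup>2 + 1)"
  have M: "0 < M\<^sup>2 + 1"
    by (simp add: add_nonneg_pos)
  have \<epsilon>: "0 < \<epsilon>" "\<epsilon> * M\<^sup>2 \<le> \<alpha>"
    using \<alpha>(1) M by (simp_all add: \<epsilon>_def field_simps)
  define \<Phi> :: "('v \<times> 'q) \<Rightarrow>\<^sub>L ('v \<times> 'q)"
    where "\<Phi> = Blinfun (\<lambda>x. (fst x - \<epsilon> *\<^sub>R \<Theta> (snd x), snd x))"
  \<comment> \<open>Without bounded linearity, \<open>Blinfun\<close> could return an unspecified
    value.\<close>
  have "bounded_linear (\<lambda>x :: 'v \<times> 'q. (fst x - \<epsilon> *\<^sub>R \<Theta> (snd x), snd x))"
    by (intro bounded_linear_intros)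
  then have \<Phi>: "\<Phi> (u, p) = (u - \<epsilon> *\<^sub>R \<Theta> p, p)" for u p
    by (simp add: \<Phi>_def bounded_linear_Blinfun_apply)
  show ?thesis
  proof (rule linearly_mapped_coerciveI)
    have "blinfun_apply \<Phi> = (\<lambda>(u, p). (u - \<epsilon> *\<^sub>R \<Theta> p, p))"
      by (auto simp: \<Phi>)
    then show "surj \<Phi>"
      by (simp only: surj_shear)
    show "0 < min (\<alpha> / 2) (\<epsilon> / 2)"
      using \<alpha> \<epsilon> by simp
    show "min (\<alpha> / 2) (\<epsilon> / 2) * (norm x)\<^sup>2 \<le> A x (\<Phi> x)" for x
    proof (cases x)
      case (Pair u p)
      have "L u (\<Theta> p) \<le> norm (L u) * norm (\<Theta> p)"
        using norm_blinfun[of "L u" "\<Theta> p"] by simp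
      also have "\<dots> \<le> (norm L * norm u) * (norm \<Theta> * norm p)"
        by (intro mult_mono norm_blinfun) auto
      finally have mixed: "L u (\<Theta> p) \<le> M * norm u * norm p"
        by (simp add: M_def mult_ac)
      have "min (\<alpha> / 2) (\<epsilon> / 2) * (norm x)\<^sup>2 \<le> \<alpha> / 2 * (norm u)\<^sup>2 + \<epsilon> / 2 * (norm p)\<^sup>2"
        unfolding Pair norm_Pair
        by (simp add: distrib_left add_mono mult_right_mono del: times_divide_eq_left)
      also have "\<dots> \<le> \<alpha> * (norm u)\<^sup>2 - \<epsilon> * (M * norm u * norm p) + \<epsilon> * (norm p)\<^sup>2"
        using \<epsilon> by (intro absorb_mixed_term) auto
      also have "\<dots> \<le> L u u - \<epsilon> * L u (\<Theta> p) + \<epsilon> * B (\<Theta> p) p"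
        using \<alpha>(2)[of u] \<Theta>[of p] mixed \<epsilon>(1)
        by (intro add_mono diff_mono mult_left_mono) auto
      \<comment> \<open>The first component contributes \<open>- B u p\<close>, which cancels the
        \<open>B u p\<close> of the second; the two minus signs at \<open>\<Theta> p\<close> make
        the last term positive in sign.\<close>
      also have "\<dots> = A x (\<Phi> x)"
        by (simp add: Pair \<Phi> assms(3) dual_pair_apply dual_operator_apply
            blinfun.bilinear_simps algebra_simps)
      finally show ?thesis .
    qed
  qed
qed

end
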